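(* Let $n,T\ge 1$, $\mathcal N=\{1,\dots,n\}$, initial inventories $c_i\in\mathbb Z_{\ge 0}$, $a_i\in\mathbb R$ $(i\in\mathcal N)$ and $\beta>0$. Fix an MNL scenario, i.e. a realization $\boldsymbol\eta=\{(\eta_{0,t},\eta_{1,t},\dots,\eta_{n,t})\}_{t=1}^T$ of real numbers. Set $$\widetilde r_{i,t}=\frac{a_i+\eta_{i,t}-\eta_{0,t}}{\beta},\qquad \mathcal B_t=\{i\in\mathcal N:\widetilde r_{i,t}\ge 0\},$$ and consider the problem $$\text{(P)}\quad\begin{aligned}\max_{\boldsymbol y}\ &\sum_{t=1}^T\sum_{i\in\mathcal N}\widetilde r_{i,t}\,y_{i,t}\\ \text{s.t. }&\sum_{t=1}^T y_{i,t}\le c_i\ (i\in\mathcal N),\qquad \sum_{i\in\mathcal N\cup\{0\}}y_{i,t}=1\ (t=1,\dots,T),\\ & y_{i,t}=0\ (i\in\mathcal N\setminus\mathcal B_t,\ t=1,\dots,T),\qquad 0\le y_{i,t}\le 1\ (i\in\mathcal N\cup\{0\},\ t=1,\dots,T).\end{aligned}$$ Then (P) solves the perfect-information dynamic pricing problem (PI) defined in the context: the two problems have the same optimal value, and any integral optimal solution $\boldsymbol y^*$ of (P) can be extended by a price vector $\boldsymbol r^*$ to an optimal solution $(\boldsymbol y^*,\boldsymbol r^* )$ of (PI). Moreover, (P) is a capacitated maximum-cost flow problem, and this linear program admits an integral optimal solution.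
   Context: The perfect-information dynamic pricing problem (PI) for the scenario $\boldsymbol\eta$ is: the firm knows all of $\boldsymbol\eta$ in advance and chooses prices $r_{i,t}$ and induced choices $y_{i,t}$ so as to $$\text{(PI)}\quad\begin{aligned}\max_{\boldsymbol y,\boldsymbol r}\ &\sum_{t=1}^T\sum_{i\in\mathcal N}r_{i,t}\,y_{i,t}\\ \text{s.t. }& I_{i,1}=c_i,\quad I_{i,t+1}=I_{i,t}-y_{i,t},\quad I_{i,t}\ge 0\quad(i\in\mathcal N,\ t=1,\dots,T),\\ &\boldsymbol y_t\in\arg\max_{\boldsymbol y\in\mathcal C(\boldsymbol I_t)}\boldsymbol U_t^\top\boldsymbol y\quad(t=1,\dots,T),\\ & y_{i,t}\in\{0,1\}\ (i\in\mathcal N\cup\{0\}),\quad r_{i,t}\ge 0\ (i\in\mathcal N),\quad t=1,\dots,T,\end{aligned}$$ where $\boldsymbol y_t=(y_{0,t},\dots,y_{n,t})$, $\boldsymbol U_t=(\eta_{0,t},U_{1,t}(r_{1,t}),\dots,U_{n,t}(r_{n,t}))$ with $U_{i,t}(r)=a_i-\beta r+\eta_{i,t}$ the realized utility of product $i$ at price $r$ (option $0$ is no purchase), $\mathcal A(\boldsymbol I)=\{i\in\mathcal N:I_i>0\}$, and $\mathcal C(\boldsymbol I)=\{\boldsymbol y\in\mathbb R_{\ge0}^{n+1}:\sum_{i\in\mathcal A(\boldsymbol I)\cup\{0\}}y_i=1,\ y_i=0\text{ for }i\notin\mathcal A(\boldsymbol I)\cup\{0\}\}$. Thus each period's customer picks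 a utility-maximizing option among available products and no purchase, with ties broken in favor of the designated option. A capacitated maximum-cost flow problem means: maximize the total reward (arc reward times arc flow) of a flow of prescribed value from a source to a sink in a finite directed network with integer arc capacities. That (P) is such a problem means that its feasible solutions correspond bijectively to the feasible flows of such a network, with equal objective values. *)

theory Defs
  imports
    Complex_Main
    "HOL-Library.FuncSet"
    "HOL-Library.Extended_Real"
    "Graph_Theory.Digraph"
begin

text \<open>
  Options are \<open>0..n\<close>, where \<open>0\<close> is no purchase, and periods are \<open>1..T\<close>. Decision vectors are
  functions on pairs (option, period) that are \<^const>\<open>extensional\<close> on the relevant index set, so that
  equality of functions is equality of finite-dimensional vectors.
\<close>

definition reservation_price ::
  "(nat \<Rightarrow> real) \<Rightarrow> real \<Rightarrow> (nat \<Rightarrow> nat \<Rightarrow> real) \<Rightarrow> nat \<Rightarrow> nat \<Rightarrow> real" where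
  "reservation_price a \<beta> \<eta> i t = (a i + \<eta> i t - \<eta> 0 t) / \<beta>"

definition sellable ::
  "nat \<Rightarrow> (nat \<Rightarrow> real) \<Rightarrow> real \<Rightarrow> (nat \<Rightarrow> nat \<Rightarrow> real) \<Rightarrow> nat \<Rightarrow> nat set" where
  "sellable n a \<beta> \<eta> t = {i \<in> {1..n}. reservation_price a \<beta> \<eta> i t \<ge> 0}"

subsection \<open>The linear program\<close>

definition P_feasible ::
  "nat \<Rightarrow> nat \<Rightarrow> (nat \<Rightarrow> nat) \<Rightarrow> (nat \<Rightarrow> real) \<Rightarrow> real \<Rightarrow> (nat \<Rightarrow> nat \<Rightarrow> real) \<Rightarrow> (nat \<times> nat \<Rightarrow> real) set" where
  "P_feasible n T c a \<beta> \<eta> =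
    {y \<in> {0..n} \<times> {1..T} \<rightarrow>\<^sub>E {0..1}.
      (\<forall>i\<in>{1..n}. (\<Sum>t=1..T. y (i, t)) \<le> real (c i)) \<and>
      (\<forall>t\<in>{1..T}. (\<Sum>i=0..n. y (i, t)) = 1) \<and>
      (\<forall>t\<in>{1..T}. \<forall>i\<in>{1..n} - sellable n a \<beta> \<eta> t. y (i, t) = 0)}"

definition P_objective ::
  "nat \<Rightarrow> nat \<Rightarrow> (nat \<Rightarrow> real) \<Rightarrow> real \<Rightarrow> (nat \<Rightarrow> nat \<Rightarrow> real) \<Rightarrow> (nat \<times> nat \<Rightarrow> real) \<Rightarrow> real" where
  "P_objective n T a \<beta> \<eta> y = (\<Sum>t=1..T. \<Sum>i=1..n. reservation_price a \<beta> \<eta> i t * y (i, t))"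

subsection \<open>The perfect-information pricing problem\<close>

definition available :: "nat \<Rightarrow> (nat \<Rightarrow> real) \<Rightarrow> nat set" where
  "available n I = {i \<in> {1..n}. I i > 0}"

definition choice_set :: "nat \<Rightarrow> (nat \<Rightarrow> real) \<Rightarrow> (nat \<Rightarrow> real) set" where
  "choice_set n I =
    {x \<in> {0..n} \<rightarrow>\<^sub>E {0..}.
      (\<Sum>i\<in>available n I \<union> {0}. x i) = 1 \<and>
      (\<forall>i\<in>{0..n} - (available n I \<union> {0}). x i = 0)}"

definition realized_utility ::
  "(nat \<Rightarrow> real) \<Rightarrow> real \<Rightarrow> (nat \<Rightarrow> nat \<Rightarrow> real) \<Rightarrow> (nat \<times> nat \<Rightarrow> real) \<Rightarrow> nat \<Rightarrow> nat \<Rightarrow> real" where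
  "realized_utility a \<beta> \<eta> r t i = (if i = 0 then \<eta> 0 t else a i - \<beta> * r (i, t) + \<eta> i t)"

definition PI_feasible ::
  "nat \<Rightarrow> nat \<Rightarrow> (nat \<Rightarrow> nat) \<Rightarrow> (nat \<Rightarrow> real) \<Rightarrow> real \<Rightarrow> (nat \<Rightarrow> nat \<Rightarrow> real) \<Rightarrow>
    ((nat \<times> nat \<Rightarrow> real) \<times> (nat \<times> nat \<Rightarrow> real)) set" where
  "PI_feasible n T c a \<beta> \<eta> =
    {(y, r).
      y \<in> {0..n} \<times> {1..T} \<rightarrow>\<^sub>E {0, 1} \<and>
      r \<in> {1..n} \<times> {1..T} \<rightarrow>\<^sub>E {0..} \<and>
      (\<exists>I :: nat \<Rightarrow> nat \<Rightarrow> real.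
        (\<forall>i\<in>{1..n}. I 1 i = real (c i)) \<and>
        (\<forall>t\<in>{1..T}. \<forall>i\<in>{1..n}. I (t + 1) i = I t i - y (i, t) \<and> I t i \<ge> 0) \<and>
        (\<forall>t\<in>{1..T}.
          is_arg_max (\<lambda>x. \<Sum>i=0..n. realized_utility a \<beta> \<eta> r t i * x i)
            (\<lambda>x. x \<in> choice_set n (I t)) (\<lambda>i\<in>{0..n}. y (i, t))))}"

definition PI_objective ::
  "nat \<Rightarrow> nat \<Rightarrow> (nat \<times> nat \<Rightarrow> real) \<times> (nat \<times> nat \<Rightarrow> real) \<Rightarrow> real" where
  "PI_objective n T = (\<lambda>(y, r). \<Sum>t=1..T. \<Sum>i=1..n. r (i, t) * y (i, t))"

subsection \<open>Optimization and network flows\<close>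

definition optimal_value :: "('a \<Rightarrow> real) \<Rightarrow> 'a set \<Rightarrow> ereal" where
  "optimal_value f S = (SUP x\<in>S. ereal (f x))"

abbreviation optimal :: "('a \<Rightarrow> real) \<Rightarrow> 'a set \<Rightarrow> 'a \<Rightarrow> bool" where
  "optimal f S \<equiv> is_arg_max f (\<lambda>x. x \<in> S)"

definition feasible_flows ::
  "('v, 'e) pre_digraph \<Rightarrow> ('e \<Rightarrow> nat) \<Rightarrow> 'v \<Rightarrow> 'v \<Rightarrow> real \<Rightarrow> ('e \<Rightarrow> real) set" where
  "feasible_flows G u s d v =
    {f \<in> (\<Pi>\<^sub>E e\<in>arcs G. {0..real (u e)}).
      (\<forall>x\<in>verts G - {s, d}. sum f (out_arcs G x) = sum f (in_arcs G x)) \<and>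
      sum f (out_arcs G s) - sum f (in_arcs G s) = v}"

text \<open>
  The problem of maximizing \<open>obj\<close> over \<open>F\<close>, a set of vectors indexed by \<open>J\<close>, is a capacitated
  maximum-cost flow problem. The bijection between feasible flows and feasible solutions reads off
  each variable as the flow on an arc of its own: an arbitrary objective-preserving bijection would
  carry little information, as it may exist for reasons of cardinality alone. The types of vertices
  and arcs are no restriction, since every finite network can be relabelled by \<open>nat\<close> and
  \<open>nat \<times> nat\<close>; arcs are not required to be the pairs of their endpoints.
\<close>
definition is_max_cost_flow_problem ::
  "'i set \<Rightarrow> ('i \<Rightarrow> real) set \<Rightarrow> (('i \<Rightarrow> real) \<Rightarrow> real) \<Rightarrow> bool" where
  "is_max_cost_flow_problem J F obj \<longleftrightarrow>
    (\<exists>(G :: (nat, nat \<times> nat) pre_digraph) u \<rho> s d v arc_of.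
      fin_digraph G \<and> s \<in> verts G \<and> d \<in> verts G \<and> s \<noteq> d \<and>
      inj_on arc_of J \<and> arc_of ` J \<subseteq> arcs G \<and>
      bij_betw (\<lambda>f. \<lambda>j\<in>J. f (arc_of j)) (feasible_flows G u s d v) F \<and>
      (\<forall>f\<in>feasible_flows G u s d v.
        (\<Sum>e\<in>arcs G. \<rho> e * f e) = obj (\<lambda>j\<in>J. f (arc_of j))))"

end

theory Submission
  imports Defs
begin

text \<open>
  A customer who buys product \<open>i\<close> in period \<open>t\<close> pays at most the reservation price, so the choices of a
  solution of the pricing problem are feasible for the linear program with at least the same objective.
  Conversely, charging the nonnegative part of the reservation price makes every sellable product
  tie with no purchase and no product beat it, so every integral solution of the program is induced by
  these prices, with equal revenue. An integral optimum exists because a fractional solution, padded by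
  slacks to a matrix with integral row and column sums, can be rounded without losing value: if \<open>m\<close>
  entries are fractional, every row or column meeting them contains at least two of them, so the
  equations preserving the row and column sums, one of which is redundant, number fewer than \<open>m\<close>. They
  have a nonzero solution supported on the fractional entries, along which one of the two directions does
  not decrease the objective and eventually makes an entry integral.
\<close>

section \<open>Rounding a matrix with integral row and column sums\<close>

text \<open>Gaussian elimination, by induction on the number of equations. An equation that vanishes
  on \<open>F\<close> is dropped; otherwise it is solved for a pivot unknown, which costs one
  equation and one unknown and so keeps the strict inequality.\<close>

lemma homogeneous_system_nontrivial_solution:
  fixes M :: "'k \<Rightarrow> 'j \<Rightarrow> real"
  assumes "finite K" "finite F" "card K < card F"
  shows "\<exists>d. (\<exists>j\<in>F. d j \<noteq> 0) \<and> (\<forall>k\<in>K. (\<Sum>j\<in>F. M k j * d j) = 0)"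
  using assms
proof (induction K arbitrary: F M rule: finite_induct)
  case empty
  then have "F \<noteq> {}" by auto
  then show ?case by (intro exI[of _ "\<lambda>_. 1"]) auto
next
  case (insert k K)
  show ?case
  proof (cases "\<forall>j\<in>F. M k j = 0")
    case True
    have "card K < card F" using insert by simp
    then obtain d where "\<exists>j\<in>F. d j \<noteq> 0" "\<forall>k\<in>K. (\<Sum>j\<in>F. M k j * d j) = 0"
      using insert.IH insert.prems by blast
    with True show ?thesis by (intro exI[of _ d]) auto
  next
    case False
    then obtain p where p: "p \<in> F" "M k p \<noteq> 0" by auto
    have "card K < card (F - {p})" using insert p by simp
    then obtain d where d: "\<exists>j\<in>F - {p}. d j \<noteq> 0"
      "\<forall>l\<in>K. (\<Sum>j\<in>F - {p}. (M l j - M l p * M k j / M k p) * d j) = 0"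
      using insert.IH[of "F - {p}" "\<lambda>l j. M l j - M l p * M k j / M k p"] insert.prems by blast
    define S where "S = (\<Sum>j\<in>F - {p}. M k j * d j)"
    \<comment> \<open>The pivot value is the one that solves equation \<open>k\<close>; the other
      equations then hold because the system solved by \<open>d\<close> already has the pivot
      eliminated.\<close>
    define d' where "d' = d(p := - S / M k p)"
    have split: "(\<Sum>j\<in>F. M l j * d' j) = M l p * (- S / M k p) + (\<Sum>j\<in>F - {p}. M l j * d j)" for l
      using p insert.prems by (subst sum.remove[of _ p]) (auto simp: d'_def intro!: sum.cong)
    have "(\<Sum>j\<in>F. M l j * d' j) = 0" if "l \<in> K" for l
    proof -
      have "0 = (\<Sum>j\<in>F - {p}. (M l j - M l p * M k j / M k p) * d j)"
        using d(2) that by simp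
      also have "\<dots> = (\<Sum>j\<in>F - {p}. M l j * d j - M l p / M k p * (M k j * d j))"
        by (simp add: left_diff_distrib mult.assoc)
      also have "\<dots> = (\<Sum>j\<in>F - {p}. M l j * d j) - M l p / M k p * S"
        by (simp add: sum_subtractf sum_distrib_left S_def)
      finally show ?thesis by (simp add: split)
    qed
    moreover have "(\<Sum>j\<in>F. M k j * d' j) = 0"
      using p by (simp add: split flip: S_def)
    moreover have "\<exists>j\<in>F. d' j \<noteq> 0" using d(1) by (auto simp: d'_def)
    ultimately show ?thesis by (intro exI[of _ d']) auto
  qed
qed

text \<open>Each nonempty fibre of \<open>f\<close> has at least two elements. With \<open>f\<close>
  a projection, this bounds the number of rows or columns met by \<open>F\<close> by half of its
  size.\<close>

lemma card_ge_twice_card_image: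
  assumes "finite F" "\<And>p. p \<in> F \<Longrightarrow> \<exists>q\<in>F. q \<noteq> p \<and> f q = f p"
  shows "2 * card (f ` F) \<le> card F"
proof -
  have two: "2 \<le> card {x \<in> F. f x = y}" if y: "y \<in> f ` F" for y
  proof -
    obtain p where p: "p \<in> F" "f p = y" using y by blast
    then obtain q where q: "q \<in> F" "q \<noteq> p" "f q = f p" using assms(2) by blast
    have "card {p, q} \<le> card {x \<in> F. f x = y}"
      using p q assms(1) by (intro card_mono) auto
    then show ?thesis using q by simp
  qed
  have "2 * card (f ` F) = (\<Sum>y\<in>f ` F. 2)" by simp
  also have "\<dots> \<le> (\<Sum>y\<in>f ` F. card {x \<in> F. f x = y})"
    using two by (intro sum_mono) auto
  also have "\<dots> = card F"
    using sum.image_gen[OF assms(1), of "\<lambda>_. 1::nat" f] by simp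
  finally show ?thesis .
qed

text \<open>\<open>F\<close> is the edge set of a bipartite graph without leaves, so the rows and
  columns that it meets number at most \<open>card F\<close> together. Dropping one of their
  equations leaves an underdetermined homogeneous system.\<close>

lemma zero_sum_direction:
  fixes A :: "'a set" and B :: "'b set"
  assumes fin: "finite A" "finite B" and F: "F \<subseteq> A \<times> B" "F \<noteq> {}"
    and row: "\<And>p. p \<in> F \<Longrightarrow> \<exists>q\<in>F. q \<noteq> p \<and> fst q = fst p"
    and col: "\<And>p. p \<in> F \<Longrightarrow> \<exists>q\<in>F. q \<noteq> p \<and> snd q = snd p"
  shows "\<exists>d :: 'a \<times> 'b \<Rightarrow> real. (\<exists>p\<in>F. d p \<noteq> 0) \<and> (\<forall>p. p \<notin> F \<longrightarrow> d p = 0) \<and>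
    (\<forall>x\<in>A. (\<Sum>y\<in>B. d (x, y)) = 0) \<and> (\<forall>y\<in>B. (\<Sum>x\<in>A. d (x, y)) = 0)"
proof -
  have finF: "finite F" using F fin by (meson finite_SigmaI finite_subset)
  obtain y0 where y0: "y0 \<in> snd ` F" using F by auto
  \<comment> \<open>One column equation is implied by the others, as the row sums and the column sums have the
    same total; without it there are fewer equations than unknowns.\<close>
  define K :: "('a + 'b) set" where "K = Inl ` fst ` F \<union> Inr ` (snd ` F - {y0})"
  define M :: "'a + 'b \<Rightarrow> 'a \<times> 'b \<Rightarrow> real" where
    "M = (\<lambda>k p. case k of Inl x \<Rightarrow> of_bool (fst p = x) | Inr y \<Rightarrow> of_bool (snd p = y))"
  have "card K = card (fst ` F) + (card (snd ` F) - 1)"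
    unfolding K_def using finF y0
    by (subst card_Un_disjoint) (auto simp: card_image)
  moreover have "card (snd ` F) \<ge> 1" using y0 finF by (simp add: Suc_le_eq card_gt_0_iff) blast
  ultimately have "card K < card F"
    using card_ge_twice_card_image[OF finF row] card_ge_twice_card_image[OF finF col] by linarith
  moreover have "finite K" using finF by (simp add: K_def)
  ultimately obtain d where d: "\<exists>p\<in>F. d p \<noteq> 0" "\<forall>k\<in>K. (\<Sum>p\<in>F. M k p * d p) = 0"
    using homogeneous_system_nontrivial_solution[OF _ finF, of K M] by auto
  define e where "e = (\<lambda>p. if p \<in> F then d p else 0)"
  have ext: "(\<Sum>p\<in>F. M k p * d p) = (\<Sum>p\<in>A \<times> B. M k p * e p)" for k
    using F fin by (intro sum.mono_neutral_cong_left) (auto simp: e_def)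
  have rows: "(\<Sum>y\<in>B. e (x, y)) = 0" if "x \<in> A" for x
  proof (cases "x \<in> fst ` F")
    case True
    then have "0 = (\<Sum>p\<in>A \<times> B. M (Inl x) p * e p)" using d(2) by (simp add: K_def ext)
    also have "\<dots> = (\<Sum>x'\<in>A. of_bool (x' = x) * (\<Sum>y\<in>B. e (x', y)))"
      by (simp add: M_def sum.cartesian_product sum_distrib_left case_prod_unfold)
    also have "\<dots> = (\<Sum>y\<in>B. e (x, y))" using that fin by (subst sum.remove[of _ x]) auto
    finally show ?thesis by simp
  next
    case False
    then show ?thesis by (intro sum.neutral) (force simp: e_def)
  qed
  have cols: "(\<Sum>x\<in>A. e (x, y)) = 0" if "y \<in> B" "y \<noteq> y0" for y
  proof (cases "y \<in> snd ` F")
    case True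
    then have "0 = (\<Sum>p\<in>A \<times> B. M (Inr y) p * e p)" using d(2) that by (simp add: K_def ext)
    also have "\<dots> = (\<Sum>x\<in>A. \<Sum>y'\<in>B. of_bool (y' = y) * e (x, y'))"
      by (simp add: M_def sum.cartesian_product case_prod_unfold)
    also have "\<dots> = (\<Sum>x\<in>A. e (x, y))" using that fin
      by (intro sum.cong refl, subst sum.remove[of _ y]) auto
    finally show ?thesis by simp
  next
    case False
    then show ?thesis by (intro sum.neutral) (force simp: e_def)
  qed
  have y0B: "y0 \<in> B" using y0 F by auto
  have "0 = (\<Sum>y\<in>B. \<Sum>x\<in>A. e (x, y))" using rows by (subst sum.swap) simp
  also have "\<dots> = (\<Sum>x\<in>A. e (x, y0))" using y0B fin cols by (subst sum.remove[of _ y0]) auto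
  finally have "(\<Sum>x\<in>A. e (x, y)) = 0" if "y \<in> B" for y using cols that by (cases "y = y0") auto
  moreover have "\<exists>p\<in>F. e p \<noteq> 0" using d(1) by (auto simp: e_def)
  ultimately show ?thesis using rows by (intro exI[of _ e]) (auto simp: e_def)
qed

text \<open>A ratio test as in the simplex method. All entries on \<open>F\<close> start strictly
  between consecutive integers, and the step ends when the first moving entry reaches one of these,
  so none is passed.\<close>

lemma integral_step_length:
  fixes z d :: "'a \<Rightarrow> real"
  assumes "finite F" "\<And>j. j \<in> F \<Longrightarrow> z j \<notin> \<int>" "\<exists>j\<in>F. d j \<noteq> 0"
  obtains \<epsilon> where "\<epsilon> > 0" "\<exists>j\<in>F. z j + \<epsilon> * d j \<in> \<int>"
    "\<And>j. j \<in> F \<Longrightarrow> of_int \<lfloor>z j\<rfloor> \<le> z j + \<epsilon> * d j \<and> z j + \<epsilon> * d j \<le> of_int \<lceil>z j\<rceil>"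
proof -
  define D where "D = {j \<in> F. d j \<noteq> 0}"
  define q where "q = (\<lambda>j. if d j > 0 then (of_int \<lceil>z j\<rceil> - z j) / d j else (z j - of_int \<lfloor>z j\<rfloor>) / (- d j))"
  define \<epsilon> where "\<epsilon> = Min (q ` D)"
  have D: "finite D" "D \<noteq> {}" using assms by (auto simp: D_def)
  have strict: "of_int \<lfloor>z j\<rfloor> < z j" "z j < of_int \<lceil>z j\<rceil>" if "j \<in> F" for j
    using assms(2)[OF that]
    by (metis Ints_of_int less_eq_real_def of_int_floor_le, metis Ints_of_int less_eq_real_def le_of_int_ceiling)
  have "\<epsilon> \<in> q ` D" unfolding \<epsilon>_def using D by (intro Min_in) auto
  then obtain j0 where j0: "j0 \<in> D" "\<epsilon> = q j0" by auto
  have qpos: "q j > 0" if "j \<in> D" for j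
    using that strict[of j] by (auto simp: q_def D_def divide_pos_neg)
  have le: "\<epsilon> \<le> q j" if "j \<in> D" for j using that D by (auto simp: \<epsilon>_def)
  have pos: "\<epsilon> > 0" using j0 qpos by simp
  have "z j0 + \<epsilon> * d j0 \<in> \<int>" using j0 by (auto simp: D_def q_def)
  moreover have "of_int \<lfloor>z j\<rfloor> \<le> z j + \<epsilon> * d j \<and> z j + \<epsilon> * d j \<le> of_int \<lceil>z j\<rceil>" if "j \<in> F" for j
  proof (cases "d j" "0 :: real" rule: linorder_cases)
    case less
    then have "\<epsilon> * - d j \<le> z j - of_int \<lfloor>z j\<rfloor>"
      using le[of j] that by (simp add: D_def q_def field_simps)
    moreover have "\<epsilon> * d j \<le> 0" using less pos by (simp add: mult_le_0_iff)
    ultimately show ?thesis using strict[OF that] by linarith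
  next
    case equal
    then show ?thesis by simp
  next
    case greater
    then have "\<epsilon> * d j \<le> of_int \<lceil>z j\<rceil> - z j"
      using le[of j] that by (simp add: D_def q_def field_simps)
    moreover have "\<epsilon> * d j \<ge> 0" using greater pos by simp
    ultimately show ?thesis using strict[OF that] by linarith
  qed
  ultimately show thesis using that[of \<epsilon>] j0 pos by (auto simp: D_def)
qed

text \<open>Otherwise \<open>f x\<close> would be a difference of integers. Thus a row or column
  with integral sum never has exactly one fractional entry.\<close>

lemma another_nonintegral_summand:
  fixes f :: "'a \<Rightarrow> real"
  assumes "finite S" "sum f S \<in> \<int>" "x \<in> S" "f x \<notin> \<int>"
  shows "\<exists>y\<in>S. y \<noteq> x \<and> f y \<notin> \<int>"
proof (rule ccontr)
  assume "\<not> ?thesis"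
  then have "sum f (S - {x}) \<in> \<int>" by (intro Ints_sum) auto
  moreover have "f x = sum f S - sum f (S - {x})" using assms by (simp add: sum.remove)
  ultimately show False using assms by (metis Ints_diff)
qed

text \<open>Induction on the number of fractional entries. Confining \<open>z'\<close> between floor
  and ceiling, rather than merely asking for integrality, is what lets integer bounds and zero
  entries survive the rounding.\<close>

lemma matrix_rounding:
  fixes z w :: "'a \<times> 'b \<Rightarrow> real"
  assumes fin: "finite A" "finite B"
    and "\<And>x. x \<in> A \<Longrightarrow> (\<Sum>y\<in>B. z (x, y)) \<in> \<int>"
    and "\<And>y. y \<in> B \<Longrightarrow> (\<Sum>x\<in>A. z (x, y)) \<in> \<int>"
  shows "\<exists>z'. (\<forall>p\<in>A \<times> B. z' p \<in> \<int> \<and> of_int \<lfloor>z p\<rfloor> \<le> z' p \<and> z' p \<le> of_int \<lceil>z p\<rceil>) \<and>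
    (\<forall>x\<in>A. (\<Sum>y\<in>B. z' (x, y)) = (\<Sum>y\<in>B. z (x, y))) \<and>
    (\<forall>y\<in>B. (\<Sum>x\<in>A. z' (x, y)) = (\<Sum>x\<in>A. z (x, y))) \<and>
    (\<Sum>p\<in>A \<times> B. w p * z p) \<le> (\<Sum>p\<in>A \<times> B. w p * z' p)"
  using assms(3-)
proof (induction "card {p \<in> A \<times> B. z p \<notin> \<int>}" arbitrary: z rule: less_induct)
  case less
  define F where "F = {p \<in> A \<times> B. z p \<notin> \<int>}"
  have finF: "finite F" using fin by (simp add: F_def)
  show ?case
  proof (cases "F = {}")
    case True
    then show ?thesis by (intro exI[of _ z]) (auto simp: F_def)
  next
    case False
    have row: "\<exists>q\<in>F. q \<noteq> p \<and> fst q = fst p" if pF: "p \<in> F" for p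
    proof -
      obtain x y where p: "p = (x, y)" "x \<in> A" "y \<in> B" "z (x, y) \<notin> \<int>"
        using pF by (auto simp: F_def)
      with another_nonintegral_summand[of B "\<lambda>y. z (x, y)" y] fin less.prems
      obtain y' where "y' \<in> B" "y' \<noteq> y" "z (x, y') \<notin> \<int>" by auto
      with p show ?thesis by (intro bexI[of _ "(x, y')"]) (auto simp: F_def)
    qed
    have col: "\<exists>q\<in>F. q \<noteq> p \<and> snd q = snd p" if pF: "p \<in> F" for p
    proof -
      obtain x y where p: "p = (x, y)" "x \<in> A" "y \<in> B" "z (x, y) \<notin> \<int>"
        using pF by (auto simp: F_def)
      with another_nonintegral_summand[of A "\<lambda>x. z (x, y)" x] fin less.prems
      obtain x' where "x' \<in> A" "x' \<noteq> x" "z (x', y) \<notin> \<int>" by auto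
      with p show ?thesis by (intro bexI[of _ "(x', y)"]) (auto simp: F_def)
    qed
    have sub: "F \<subseteq> A \<times> B" by (auto simp: F_def)
    obtain d0 :: "'a \<times> 'b \<Rightarrow> real" where d0: "\<exists>p\<in>F. d0 p \<noteq> 0"
      "\<And>p. p \<notin> F \<Longrightarrow> d0 p = 0"
      "\<And>x. x \<in> A \<Longrightarrow> (\<Sum>y\<in>B. d0 (x, y)) = 0" "\<And>y. y \<in> B \<Longrightarrow> (\<Sum>x\<in>A. d0 (x, y)) = 0"
      using zero_sum_direction[OF fin sub False row col] by blast
    define s :: real where "s = (if (\<Sum>p\<in>A \<times> B. w p * d0 p) \<ge> 0 then 1 else -1)"
    define d where "d = (\<lambda>p. s * d0 p)"
    have d: "\<exists>p\<in>F. d p \<noteq> 0" "\<And>p. p \<notin> F \<Longrightarrow> d p = 0"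
      "\<And>x. x \<in> A \<Longrightarrow> (\<Sum>y\<in>B. d (x, y)) = 0" "\<And>y. y \<in> B \<Longrightarrow> (\<Sum>x\<in>A. d (x, y)) = 0"
      using d0 by (auto simp: d_def s_def sum_negf)
    have gain: "(\<Sum>p\<in>A \<times> B. w p * d p) \<ge> 0"
      by (auto simp: d_def s_def sum_negf)
    obtain \<epsilon> where \<epsilon>: "\<epsilon> > 0" "\<exists>j\<in>F. z j + \<epsilon> * d j \<in> \<int>"
      "\<And>j. j \<in> F \<Longrightarrow> of_int \<lfloor>z j\<rfloor> \<le> z j + \<epsilon> * d j \<and> z j + \<epsilon> * d j \<le> of_int \<lceil>z j\<rceil>"
      using integral_step_length[OF finF _ d(1), of z] by (auto simp: F_def)
    define z1 where "z1 = (\<lambda>p. z p + \<epsilon> * d p)"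
    have bnd: "of_int \<lfloor>z p\<rfloor> \<le> z1 p" "z1 p \<le> of_int \<lceil>z p\<rceil>" for p
      using \<epsilon>(3)[of p] d(2)[of p] by (cases "p \<in> F"; simp add: z1_def)+
    have rows: "(\<Sum>y\<in>B. z1 (x, y)) = (\<Sum>y\<in>B. z (x, y))" if "x \<in> A" for x
      using d(3)[OF that] by (simp add: z1_def sum.distrib flip: sum_distrib_left)
    have cols: "(\<Sum>x\<in>A. z1 (x, y)) = (\<Sum>x\<in>A. z (x, y))" if "y \<in> B" for y
      using d(4)[OF that] by (simp add: z1_def sum.distrib flip: sum_distrib_left)
    have "(\<Sum>p\<in>A \<times> B. w p * z1 p) = (\<Sum>p\<in>A \<times> B. w p * z p) + \<epsilon> * (\<Sum>p\<in>A \<times> B. w p * d p)"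
      by (simp add: z1_def algebra_simps sum.distrib sum_distrib_left)
    then have obj: "(\<Sum>p\<in>A \<times> B. w p * z p) \<le> (\<Sum>p\<in>A \<times> B. w p * z1 p)"
      using gain \<epsilon>(1) by simp
    have "{p \<in> A \<times> B. z1 p \<notin> \<int>} \<subset> F"
    proof
      show "{p \<in> A \<times> B. z1 p \<notin> \<int>} \<subseteq> F" using d(2) by (fastforce simp: z1_def F_def)
      show "{p \<in> A \<times> B. z1 p \<notin> \<int>} \<noteq> F" using \<epsilon>(2) by (auto simp: z1_def)
    qed
    then have "card {p \<in> A \<times> B. z1 p \<notin> \<int>} < card {p \<in> A \<times> B. z p \<notin> \<int>}"
      using psubset_card_mono[OF finF] by (simp add: F_def)
    with less.hyps[of z1] rows cols less.prems obtain z' where z':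
      "\<forall>p\<in>A \<times> B. z' p \<in> \<int> \<and> of_int \<lfloor>z1 p\<rfloor> \<le> z' p \<and> z' p \<le> of_int \<lceil>z1 p\<rceil>"
      "\<forall>x\<in>A. (\<Sum>y\<in>B. z' (x, y)) = (\<Sum>y\<in>B. z1 (x, y))"
      "\<forall>y\<in>B. (\<Sum>x\<in>A. z' (x, y)) = (\<Sum>x\<in>A. z1 (x, y))"
      "(\<Sum>p\<in>A \<times> B. w p * z1 p) \<le> (\<Sum>p\<in>A \<times> B. w p * z' p)"
      by auto
    have "of_int \<lfloor>z p\<rfloor> \<le> z' p \<and> z' p \<le> of_int \<lceil>z p\<rceil>" if "p \<in> A \<times> B" for p
    proof -
      \<comment> \<open>The interval from floor to ceiling of \<open>z1 p\<close> lies within that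
        of \<open>z p\<close>, so the bounds from the induction hypothesis carry over.\<close>
      have "\<lfloor>z p\<rfloor> \<le> \<lfloor>z1 p\<rfloor>" "\<lceil>z1 p\<rceil> \<le> \<lceil>z p\<rceil>"
        using bnd[of p] by (auto simp: le_floor_iff ceiling_le_iff)
      then have "real_of_int \<lfloor>z p\<rfloor> \<le> of_int \<lfloor>z1 p\<rfloor>" "real_of_int \<lceil>z1 p\<rceil> \<le> of_int \<lceil>z p\<rceil>"
        by simp_all
      then show ?thesis using z'(1) that by force
    qed
    with z' rows cols obj show ?thesis by (intro exI[of _ z']) auto
  qed
qed

section \<open>Integral optimal solutions of the linear program\<close>

lemma optimal_iff: "optimal f S x \<longleftrightarrow> x \<in> S \<and> (\<forall>y\<in>S. f y \<le> f x)"
  by (auto simp: is_arg_max_linorder)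

lemma optimal_value_eq: "optimal f S x \<Longrightarrow> optimal_value f S = ereal (f x)"
  unfolding optimal_value_def optimal_iff
  by (intro antisym SUP_least SUP_upper2[of x]) auto

lemma P_objective_eq_sum_pairs:
  "P_objective n T a \<beta> \<eta> y =
    (\<Sum>p\<in>{1..n} \<times> {1..T}. reservation_price a \<beta> \<eta> (fst p) (snd p) * y p)"
  unfolding P_objective_def by (subst sum.swap) (simp add: sum.cartesian_product')

text \<open>Meant for larger index sets: the slack column of the padded matrix and the additional
  arcs of the network get weight zero, so both weighted sums reduce to the objective of the
  program.\<close>

lemma P_objective_eq_weighted_sum:
  assumes "finite J" "{1..n} \<times> {1..T} \<subseteq> J" "\<And>p. p \<in> {1..n} \<times> {1..T} \<Longrightarrow> x p = y p"
  shows "(\<Sum>p\<in>J. (if p \<in> {1..n} \<times> {1..T} then reservation_price a \<beta> \<eta> (fst p) (snd p) else 0) * x p)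
    = P_objective n T a \<beta> \<eta> y"
  unfolding P_objective_eq_sum_pairs using assms
  by (intro sum.mono_neutral_cong_right) auto

lemma P_feasible_iff:
  "y \<in> P_feasible n T c a \<beta> \<eta> \<longleftrightarrow>
    y \<in> extensional ({0..n} \<times> {1..T}) \<and>
    (\<forall>i\<in>{0..n}. \<forall>t\<in>{1..T}. 0 \<le> y (i, t) \<and> y (i, t) \<le> 1) \<and>
    (\<forall>i\<in>{1..n}. (\<Sum>t=1..T. y (i, t)) \<le> real (c i)) \<and>
    (\<forall>t\<in>{1..T}. (\<Sum>i=0..n. y (i, t)) = 1) \<and>
    (\<forall>t\<in>{1..T}. \<forall>i\<in>{1..n} - sellable n a \<beta> \<eta> t. y (i, t) = 0)"
proof -
  have "y \<in> {0..n} \<times> {1..T} \<rightarrow>\<^sub>E {0..1} \<longleftrightarrow> y \<in> extensional ({0..n} \<times> {1..T}) \<and>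
    (\<forall>i\<in>{0..n}. \<forall>t\<in>{1..T}. 0 \<le> y (i, t) \<and> y (i, t) \<le> 1)"
    unfolding PiE_iff by auto
  then show ?thesis by (simp only: P_feasible_def mem_Collect_eq conj_assoc)
qed

text \<open>The equality constraints survive as preserved column sums. Each inequality and each
  prescribed zero bounds a matrix entry by an integer, which floors and ceilings respect; the
  inventory constraints are of this kind through their slacks.\<close>

lemma P_feasible_rounding:
  assumes y: "y \<in> P_feasible n T c a \<beta> \<eta>"
  shows "\<exists>x\<in>P_feasible n T c a \<beta> \<eta>. (\<forall>p\<in>{0..n} \<times> {1..T}. x p \<in> \<int>) \<and>
    P_objective n T a \<beta> \<eta> y \<le> P_objective n T a \<beta> \<eta> x"
proof -
  \<comment> \<open>Column \<open>0\<close> holds the slacks of the inventory constraints, and the entry \<open>(0, 0)\<close> makes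
    row \<open>0\<close> sum to \<open>0\<close>; all row and column sums are then integral.\<close>
  define z where "z = (\<lambda>(i, t). if t \<ge> 1 then y (i, t)
    else (if i = 0 then 0 else real (c i)) - (\<Sum>t=1..T. y (i, t)))"
  define w where "w = (\<lambda>p. if p \<in> {1..n} \<times> {1..T} then reservation_price a \<beta> \<eta> (fst p) (snd p) else 0)"
  have peel: "(\<Sum>t=0..T. g t) = g 0 + (\<Sum>t=1..T. g t)" for g :: "nat \<Rightarrow> real"
    by (simp add: sum.atLeast_Suc_atMost)
  have rows: "(\<Sum>t=0..T. z (i, t)) = (if i = 0 then 0 else real (c i))" for i
    by (simp add: peel z_def)
  have cols1: "(\<Sum>i=0..n. z (i, t)) = 1" if "t \<in> {1..T}" for t
    using y that by (simp add: z_def P_feasible_iff)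
  \<comment> \<open>Summing the matrix both ways determines the total of the slack column: the sum
    of the row totals minus \<open>T\<close>.\<close>
  have "(\<Sum>i=0..n. \<Sum>t=0..T. z (i, t)) = (\<Sum>t=0..T. \<Sum>i=0..n. z (i, t))" by (rule sum.swap)
  also have "\<dots> = (\<Sum>i=0..n. z (i, 0)) + real T" using cols1 by (simp add: peel)
  finally have "(\<Sum>i=0..n. z (i, 0)) = (\<Sum>i=0..n. if i = 0 then 0 else real (c i)) - real T"
    by (simp add: rows)
  moreover have "\<dots> \<in> \<int>" by (intro Ints_diff Ints_sum) auto
  ultimately have col0: "(\<Sum>i=0..n. z (i, 0)) \<in> \<int>" by simp
  have "(\<Sum>t\<in>{0..T}. z (i, t)) \<in> \<int>" for i by (simp add: rows)
  moreover have "(\<Sum>i\<in>{0..n}. z (i, t)) \<in> \<int>" if "t \<in> {0..T}" for t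
    using col0 cols1[of t] that by (cases "t = 0") auto
  ultimately obtain x where x:
    "\<forall>p\<in>{0..n} \<times> {0..T}. x p \<in> \<int> \<and> of_int \<lfloor>z p\<rfloor> \<le> x p \<and> x p \<le> of_int \<lceil>z p\<rceil>"
    "\<forall>i\<in>{0..n}. (\<Sum>t\<in>{0..T}. x (i, t)) = (\<Sum>t\<in>{0..T}. z (i, t))"
    "\<forall>t\<in>{0..T}. (\<Sum>i\<in>{0..n}. x (i, t)) = (\<Sum>i\<in>{0..n}. z (i, t))"
    "(\<Sum>p\<in>{0..n} \<times> {0..T}. w p * z p) \<le> (\<Sum>p\<in>{0..n} \<times> {0..T}. w p * x p)"
    using matrix_rounding[of "{0..n}" "{0..T}" z w]
    by blast
  define x' where "x' = restrict x ({0..n} \<times> {1..T})"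
  have x': "x' (i, t) = x (i, t)" if "i \<in> {0..n}" "t \<in> {1..T}" for i t
    using that by (simp add: x'_def)
  have bounds: "of_int \<lfloor>y (i, t)\<rfloor> \<le> x (i, t) \<and> x (i, t) \<le> of_int \<lceil>y (i, t)\<rceil>"
    if "i \<in> {0..n}" "t \<in> {1..T}" for i t
  proof -
    have "z (i, t) = y (i, t)" using that by (simp add: z_def)
    moreover have "(i, t) \<in> {0..n} \<times> {0..T}" using that by simp
    ultimately show ?thesis using x(1) by metis
  qed
  have unit: "0 \<le> x (i, t) \<and> x (i, t) \<le> 1" if it: "i \<in> {0..n}" "t \<in> {1..T}" for i t
  proof -
    have "0 \<le> y (i, t)" "y (i, t) \<le> 1" using y it unfolding P_feasible_iff by blast+
    then have "0 \<le> \<lfloor>y (i, t)\<rfloor>" "\<lceil>y (i, t)\<rceil> \<le> 1" by (auto simp: ceiling_le_iff)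
    then have "0 \<le> real_of_int \<lfloor>y (i, t)\<rfloor>" "real_of_int \<lceil>y (i, t)\<rceil> \<le> 1" by simp_all
    with bounds[OF it] show ?thesis by linarith
  qed
  \<comment> \<open>The slack is nonnegative, hence so are its floor and its rounded value; the
    preserved row sum turns this into the inventory bound.\<close>
  have inv: "(\<Sum>t=1..T. x (i, t)) \<le> real (c i)" if "i \<in> {1..n}" for i
  proof -
    have "0 \<le> z (i, 0)" using y that by (auto simp: z_def P_feasible_iff)
    then have "0 \<le> real_of_int \<lfloor>z (i, 0)\<rfloor>" by simp
    also have "\<dots> \<le> x (i, 0)" using x(1) that by auto
    finally have "0 \<le> x (i, 0)" .
    moreover have "x (i, 0) + (\<Sum>t=1..T. x (i, t)) = real (c i)"
      using x(2) that rows[of i] by (simp add: peel)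
    ultimately show ?thesis by linarith
  qed
  have "x' \<in> P_feasible n T c a \<beta> \<eta>"
    unfolding P_feasible_iff
  proof (intro conjI ballI)
    show "x' \<in> extensional ({0..n} \<times> {1..T})" by (simp add: x'_def)
  next
    fix i assume "i \<in> {1..n}"
    then show "(\<Sum>t=1..T. x' (i, t)) \<le> real (c i)" using inv[of i] by (simp add: x')
  next
    fix t assume t: "t \<in> {1..T}"
    then have "(\<Sum>i=0..n. x (i, t)) = 1" using x(3) cols1[of t] by simp
    with t show "(\<Sum>i=0..n. x' (i, t)) = 1" by (simp add: x')
  next
    fix t i assume t: "t \<in> {1..T}" and i: "i \<in> {1..n} - sellable n a \<beta> \<eta> t"
    then have "y (i, t) = 0" using y by (auto simp: P_feasible_iff)
    with bounds[of i t] t i show "x' (i, t) = 0" by (auto simp: x')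
  qed (use unit in \<open>auto simp: x'\<close>)
  moreover have "\<forall>p\<in>{0..n} \<times> {1..T}. x' p \<in> \<int>"
    using x(1) by (auto simp: x'_def)
  moreover have "P_objective n T a \<beta> \<eta> y \<le> P_objective n T a \<beta> \<eta> x'"
  proof -
    have "P_objective n T a \<beta> \<eta> y = (\<Sum>p\<in>{0..n} \<times> {0..T}. w p * z p)"
      unfolding w_def by (rule P_objective_eq_weighted_sum[symmetric]) (auto simp: z_def)
    also note x(4)
    also have "(\<Sum>p\<in>{0..n} \<times> {0..T}. w p * x p) = P_objective n T a \<beta> \<eta> x'"
      unfolding w_def by (rule P_objective_eq_weighted_sum) (auto simp: x'_def)
    finally show ?thesis .
  qed
  ultimately show ?thesis by blast
qed

lemma integral_P_feasible_binary:
  assumes "y \<in> P_feasible n T c a \<beta> \<eta>" "\<forall>p\<in>{0..n} \<times> {1..T}. y p \<in> \<int>"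
    and "i \<in> {0..n}" "t \<in> {1..T}"
  shows "y (i, t) = 0 \<or> y (i, t) = 1"
proof -
  have "y (i, t) \<in> \<int>" using assms by blast
  then obtain k where k: "y (i, t) = of_int k" by (rule Ints_cases)
  have "0 \<le> y (i, t)" "y (i, t) \<le> 1" using assms unfolding P_feasible_iff by blast+
  then have "k = 0 \<or> k = 1" unfolding k by simp linarith
  then show ?thesis using k by auto
qed

text \<open>Integral feasible solutions are 0-1 vectors, so there are finitely many and one of them
  is best. Rounding shows that no fractional solution beats it.\<close>

lemma integral_P_optimal_exists:
  "\<exists>y. optimal (P_objective n T a \<beta> \<eta>) (P_feasible n T c a \<beta> \<eta>) y \<and>
     (\<forall>p\<in>{0..n} \<times> {1..T}. y p \<in> \<int>)"
proof -
  define S where "S = {y \<in> P_feasible n T c a \<beta> \<eta>. \<forall>p\<in>{0..n} \<times> {1..T}. y p \<in> \<int>}"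
  have "S \<subseteq> {0..n} \<times> {1..T} \<rightarrow>\<^sub>E {0, 1}"
  proof
    fix y assume y: "y \<in> S"
    then have "y p \<in> {0, 1}" if "p \<in> {0..n} \<times> {1..T}" for p
      using integral_P_feasible_binary[of y n T c a \<beta> \<eta> "fst p" "snd p"] that by (auto simp: S_def)
    moreover have "y \<in> extensional ({0..n} \<times> {1..T})" using y by (auto simp: S_def P_feasible_iff)
    ultimately show "y \<in> {0..n} \<times> {1..T} \<rightarrow>\<^sub>E {0, 1}" by (auto simp: PiE_def)
  qed
  moreover have "finite ({0..n} \<times> {1..T} \<rightarrow>\<^sub>E {0, 1 :: real})" by (intro finite_PiE) auto
  ultimately have fin: "finite S" by (rule finite_subset)
  \<comment> \<open>Nobody ever buys anything: this is feasible for all inventories.\<close>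
  have "restrict (\<lambda>(i, t). if i = 0 then 1 else 0) ({0..n} \<times> {1..T}) \<in> S"
    by (auto simp: S_def P_feasible_iff sum.atLeast_Suc_atMost)
  then have "S \<noteq> {}" by auto
  then have "Max (P_objective n T a \<beta> \<eta> ` S) \<in> P_objective n T a \<beta> \<eta> ` S"
    using fin by (intro Max_in) auto
  then obtain x where "x \<in> S" "P_objective n T a \<beta> \<eta> x = Max (P_objective n T a \<beta> \<eta> ` S)" by auto
  with fin have x: "x \<in> S" "\<forall>y\<in>S. P_objective n T a \<beta> \<eta> y \<le> P_objective n T a \<beta> \<eta> x" by auto
  have "P_objective n T a \<beta> \<eta> y \<le> P_objective n T a \<beta> \<eta> x" if "y \<in> P_feasible n T c a \<beta> \<eta>" for y
    using P_feasible_rounding[OF that] x(2) by (force simp: S_def)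
  with x(1) show ?thesis unfolding optimal_iff by (intro exI[of _ x]) (auto simp: S_def)
qed

section \<open>Reservation prices\<close>

lemma choice_set_sum:
  assumes "x \<in> choice_set n I"
  shows "(\<Sum>i=0..n. x i) = 1"
proof -
  have "(\<Sum>i=0..n. x i) = (\<Sum>i\<in>available n I \<union> {0}. x i)"
    using assms by (intro sum.mono_neutral_right) (auto simp: choice_set_def available_def)
  then show ?thesis using assms by (simp add: choice_set_def)
qed

text \<open>Truncation at zero meets the sign constraint on prices. For \<open>\<beta> > 0\<close>,
  a product with negative reservation price stays worse than no purchase even when it is
  free.\<close>

definition reservation_prices ::
  "nat \<Rightarrow> nat \<Rightarrow> (nat \<Rightarrow> real) \<Rightarrow> real \<Rightarrow> (nat \<Rightarrow> nat \<Rightarrow> real) \<Rightarrow> nat \<times> nat \<Rightarrow> real" where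
  "reservation_prices n T a \<beta> \<eta> =
    restrict (\<lambda>(i, t). max 0 (reservation_price a \<beta> \<eta> i t)) ({1..n} \<times> {1..T})"

lemma reservation_price_nonneg_of_sold:
  assumes "y \<in> P_feasible n T c a \<beta> \<eta>" "i \<in> {1..n}" "t \<in> {1..T}" "y (i, t) \<noteq> 0"
  shows "reservation_price a \<beta> \<eta> i t \<ge> 0"
proof -
  have "i \<in> sellable n a \<beta> \<eta> t" using assms unfolding P_feasible_iff by blast
  then show ?thesis by (simp add: sellable_def)
qed

lemma PI_objective_reservation_prices:
  assumes "y \<in> P_feasible n T c a \<beta> \<eta>"
  shows "PI_objective n T (y, reservation_prices n T a \<beta> \<eta>) = P_objective n T a \<beta> \<eta> y"
proof -
  have "reservation_prices n T a \<beta> \<eta> (i, t) * y (i, t) = reservation_price a \<beta> \<eta> i t * y (i, t)"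
    if "i \<in> {1..n}" "t \<in> {1..T}" for i t
    using reservation_price_nonneg_of_sold[OF assms that] that
    by (cases "y (i, t) = 0") (auto simp: reservation_prices_def)
  then show ?thesis
    unfolding PI_objective_def P_objective_def prod.case by (intro sum.cong refl)
qed

text \<open>Under these prices the utility of no purchase bounds that of every option and is
  attained by every option that \<open>y\<close> uses. A choice vector is a convex combination of
  options, so \<open>y\<close> is a maximizer in each period once it is supported on available
  options.\<close>

lemma PI_feasible_reservation_prices:
  assumes \<beta>: "\<beta> > 0" and y: "y \<in> P_feasible n T c a \<beta> \<eta>" and int: "\<forall>p\<in>{0..n} \<times> {1..T}. y p \<in> \<int>"
  shows "(y, reservation_prices n T a \<beta> \<eta>) \<in> PI_feasible n T c a \<beta> \<eta>"
proof -
  define r where "r = reservation_prices n T a \<beta> \<eta>"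
  have r: "r (i, t) = max 0 (reservation_price a \<beta> \<eta> i t)" if "i \<in> {1..n}" "t \<in> {1..T}" for i t
    using that by (simp add: r_def reservation_prices_def)
  have y0: "y (i, t) \<ge> 0" if "i \<in> {0..n}" "t \<in> {1..T}" for i t
    using y that by (simp add: P_feasible_iff)
  note sell = reservation_price_nonneg_of_sold[OF y]
  define I where "I = (\<lambda>t i. real (c i) - (\<Sum>s\<in>{1..<t}. y (i, s)))"
  have I_Suc: "I (t + 1) i = I t i - y (i, t)" if "t \<in> {1..T}" for t i
    using that by (simp add: I_def)
  \<comment> \<open>The bound extends to \<open>T + 1\<close> because availability in a period is
    read off from the inventory left after it.\<close>
  have I_nonneg: "I t i \<ge> 0" if "t \<le> T + 1" "i \<in> {1..n}" for t i
  proof -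
    have "(\<Sum>s\<in>{1..<t}. y (i, s)) \<le> (\<Sum>s\<in>{1..T}. y (i, s))"
      using that y0 by (intro sum_mono2) auto
    also have "\<dots> \<le> real (c i)" using y that by (auto simp: P_feasible_iff)
    finally show ?thesis by (simp add: I_def)
  qed
  have U_le: "realized_utility a \<beta> \<eta> r t i \<le> \<eta> 0 t" if "i \<in> {0..n}" "t \<in> {1..T}" for i t
  proof (cases "i = 0")
    case False
    then have "\<beta> * r (i, t) \<ge> \<beta> * reservation_price a \<beta> \<eta> i t"
      using \<beta> that by (intro mult_left_mono) (auto simp: r)
    then show ?thesis using False \<beta> by (simp add: realized_utility_def reservation_price_def)
  qed (simp add: realized_utility_def)
  have U_eq: "realized_utility a \<beta> \<eta> r t i = \<eta> 0 t"
    if "i \<in> {0..n}" "t \<in> {1..T}" "y (i, t) \<noteq> 0" for i t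
  proof (cases "i = 0")
    case False
    then have "r (i, t) = reservation_price a \<beta> \<eta> i t"
      using sell[of i t] that by (auto simp: r)
    then show ?thesis using False \<beta> by (simp add: realized_utility_def reservation_price_def)
  qed (simp add: realized_utility_def)
  have opt: "is_arg_max (\<lambda>x. \<Sum>i=0..n. realized_utility a \<beta> \<eta> r t i * x i)
      (\<lambda>x. x \<in> choice_set n (I t)) (\<lambda>i\<in>{0..n}. y (i, t))" if t: "t \<in> {1..T}" for t
    unfolding optimal_iff
  proof (intro conjI ballI)
    have sum1: "(\<Sum>i=0..n. y (i, t)) = 1" using y t by (auto simp: P_feasible_iff)
    \<comment> \<open>Using an option without stock would make the next inventory negative.\<close>
    have sold: "y (i, t) = 0" if "i \<in> {0..n} - (available n (I t) \<union> {0})" for i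
    proof -
      have "I t i \<le> 0" using that by (auto simp: available_def)
      moreover have "I (t + 1) i \<ge> 0" using I_nonneg[of "t + 1" i] t that by auto
      ultimately show ?thesis using I_Suc[OF t, of i] y0[of i t] t that by auto
    qed
    have "(\<Sum>i\<in>available n (I t) \<union> {0}. y (i, t)) = (\<Sum>i=0..n. y (i, t))"
      using sold by (intro sum.mono_neutral_left) (auto simp: available_def)
    moreover have "(\<Sum>i\<in>available n (I t) \<union> {0}. (\<lambda>i\<in>{0..n}. y (i, t)) i)
      = (\<Sum>i\<in>available n (I t) \<union> {0}. y (i, t))"
      by (intro sum.cong) (auto simp: available_def)
    ultimately show "(\<lambda>i\<in>{0..n}. y (i, t)) \<in> choice_set n (I t)"
      using sum1 sold y0 t by (auto simp: choice_set_def)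
    fix x assume x: "x \<in> choice_set n (I t)"
    then have "x i \<ge> 0" if "i \<in> {0..n}" for i using that by (auto simp: choice_set_def)
    then have "(\<Sum>i=0..n. realized_utility a \<beta> \<eta> r t i * x i) \<le> (\<Sum>i=0..n. \<eta> 0 t * x i)"
      using U_le t by (intro sum_mono mult_right_mono) auto
    also have "\<dots> = (\<Sum>i=0..n. \<eta> 0 t * y (i, t))"
      using choice_set_sum[OF x] sum1 by (simp flip: sum_distrib_left)
    also have "\<dots> = (\<Sum>i=0..n. realized_utility a \<beta> \<eta> r t i * (\<lambda>i\<in>{0..n}. y (i, t)) i)"
      using U_eq t by (intro sum.cong) force+
    finally show "(\<Sum>i=0..n. realized_utility a \<beta> \<eta> r t i * x i) \<le> \<dots>" .
  qed
  have "y \<in> {0..n} \<times> {1..T} \<rightarrow>\<^sub>E {0, 1}"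
  proof
    fix p assume "p \<in> {0..n} \<times> {1..T}"
    then show "y p \<in> {0, 1}" using integral_P_feasible_binary[OF y int, of "fst p" "snd p"] by auto
  next
    have "y \<in> extensional ({0..n} \<times> {1..T})" using y unfolding P_feasible_iff by (rule conjunct1)
    then show "y p = undefined" if "p \<notin> {0..n} \<times> {1..T}" for p
      using that by (rule extensional_arb)
  qed
  moreover have "r \<in> {1..n} \<times> {1..T} \<rightarrow>\<^sub>E {0..}" by (auto simp: r_def reservation_prices_def)
  moreover have "I 1 i = real (c i)" for i by (simp add: I_def)
  moreover have "I (t + 1) i = I t i - y (i, t) \<and> I t i \<ge> 0" if "t \<in> {1..T}" "i \<in> {1..n}" for t i
    using I_Suc[OF that(1)] I_nonneg[of t i] that by auto
  ultimately have "(y, r) \<in> PI_feasible n T c a \<beta> \<eta>"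
    unfolding PI_feasible_def using opt by blast
  then show ?thesis by (simp only: r_def)
qed

section \<open>From solutions of the pricing problem to the linear program\<close>

lemma PI_feasible_binary:
  assumes "(y, r) \<in> PI_feasible n T c a \<beta> \<eta>" "i \<in> {0..n}" "t \<in> {1..T}"
  shows "y (i, t) = 0 \<or> y (i, t) = 1"
proof -
  have "y \<in> {0..n} \<times> {1..T} \<rightarrow>\<^sub>E {0, 1}" using assms(1) unfolding PI_feasible_def by blast
  then have "y (i, t) \<in> {0, 1}" by (rule PiE_mem) (use assms in simp)
  then show ?thesis by simp
qed

text \<open>The customer can always decline, so the utility of the product sold is at least that of
  no purchase; solving for the price gives the bound.\<close>

lemma PI_feasible_price_le:
  assumes \<beta>: "\<beta> > 0" and yr: "(y, r) \<in> PI_feasible n T c a \<beta> \<eta>"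
    and i: "i \<in> {1..n}" and t: "t \<in> {1..T}" and sold: "y (i, t) = 1"
  shows "r (i, t) \<le> reservation_price a \<beta> \<eta> i t"
proof -
  obtain I :: "nat \<Rightarrow> nat \<Rightarrow> real" where
    opt: "is_arg_max (\<lambda>x. \<Sum>i=0..n. realized_utility a \<beta> \<eta> r t i * x i)
            (\<lambda>x. x \<in> choice_set n (I t)) (\<lambda>i\<in>{0..n}. y (i, t))"
    using yr t unfolding PI_feasible_def by blast
  then have "(\<lambda>i\<in>{0..n}. y (i, t)) \<in> choice_set n (I t)" unfolding optimal_iff by (rule conjunct1)
  from choice_set_sum[OF this] have sum1: "(\<Sum>i=0..n. y (i, t)) = 1" by simp
  \<comment> \<open>A choice vector has total one, so \<open>i\<close> is the only option used and
    the maximal utility is that of \<open>i\<close>.\<close>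
  have "(\<Sum>j\<in>{0..n} - {i}. y (j, t)) = 0"
    using sum1 i sold by (simp add: sum.remove[of "{0..n}" i])
  moreover have "y (j, t) \<ge> 0" if "j \<in> {0..n}" for j using PI_feasible_binary[OF yr that t] by auto
  ultimately have others: "y (j, t) = 0" if "j \<in> {0..n} - {i}" for j
    using that by (subst (asm) sum_nonneg_eq_0_iff) auto
  define x where "x = (\<lambda>j\<in>{0..n}. if j = 0 then 1 else 0 :: real)"
  have x0: "(\<Sum>j=0..n. realized_utility a \<beta> \<eta> r t j * x j) = \<eta> 0 t"
    by (simp add: x_def sum.atLeast_Suc_atMost realized_utility_def)
  have "(\<Sum>j\<in>available n (I t) \<union> {0}. x j) = (\<Sum>j\<in>{0}. x j)"
    by (intro sum.mono_neutral_right) (auto simp: x_def available_def)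
  then have "x \<in> choice_set n (I t)" by (auto simp: choice_set_def x_def)
  then have "\<eta> 0 t \<le> (\<Sum>j=0..n. realized_utility a \<beta> \<eta> r t j * (\<lambda>j\<in>{0..n}. y (j, t)) j)"
    using opt unfolding x0[symmetric] optimal_iff by blast
  also have "\<dots> = realized_utility a \<beta> \<eta> r t i"
    using i others sold by (subst sum.remove[of _ i]) auto
  also have "\<dots> = a i - \<beta> * r (i, t) + \<eta> i t" using i by (simp add: realized_utility_def)
  finally show ?thesis using \<beta> by (simp add: reservation_price_def field_simps)
qed

lemma PI_objective_le_P_objective:
  assumes "\<beta> > 0" "(y, r) \<in> PI_feasible n T c a \<beta> \<eta>"
  shows "PI_objective n T (y, r) \<le> P_objective n T a \<beta> \<eta> y"
proof -
  have "r (i, t) * y (i, t) \<le> reservation_price a \<beta> \<eta> i t * y (i, t)"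
    if "i \<in> {1..n}" "t \<in> {1..T}" for i t
    using PI_feasible_price_le[OF assms that] PI_feasible_binary[OF assms(2), of i t] that by auto
  then show ?thesis
    unfolding PI_objective_def P_objective_def by (auto intro!: sum_mono)
qed

text \<open>The delicate constraint is the inventory bound: nonnegativity is imposed only at the
  start of periods \<open>1\<close> to \<open>T\<close>, not on the stock left after period
  \<open>T\<close>. A product sold in period \<open>T\<close> is available and thus has positive
  stock, which is at least one by integrality. A sold product is sellable, as its nonnegative price
  is at most its reservation price.\<close>

lemma P_feasible_of_PI_feasible:
  assumes \<beta>: "\<beta> > 0" and T: "T \<ge> 1" and yr: "(y, r) \<in> PI_feasible n T c a \<beta> \<eta>"
  shows "y \<in> P_feasible n T c a \<beta> \<eta>"
proof -
  obtain I :: "nat \<Rightarrow> nat \<Rightarrow> real" where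
    bin: "y \<in> {0..n} \<times> {1..T} \<rightarrow>\<^sub>E {0, 1}" and r: "r \<in> {1..n} \<times> {1..T} \<rightarrow>\<^sub>E {0..}" and
    I1: "\<forall>i\<in>{1..n}. I 1 i = real (c i)" and
    IS: "\<forall>t\<in>{1..T}. \<forall>i\<in>{1..n}. I (t + 1) i = I t i - y (i, t) \<and> I t i \<ge> 0" and
    opt: "\<forall>t\<in>{1..T}. is_arg_max (\<lambda>x. \<Sum>i=0..n. realized_utility a \<beta> \<eta> r t i * x i)
            (\<lambda>x. x \<in> choice_set n (I t)) (\<lambda>i\<in>{0..n}. y (i, t))"
    using yr unfolding PI_feasible_def by blast
  have y01: "y (i, t) = 0 \<or> y (i, t) = 1" if "i \<in> {0..n}" "t \<in> {1..T}" for i t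
    using PI_feasible_binary[OF yr that] .
  have choice: "(\<lambda>i\<in>{0..n}. y (i, t)) \<in> choice_set n (I t)" if "t \<in> {1..T}" for t
    using opt that unfolding optimal_iff by blast
  have sum1: "(\<Sum>i=0..n. y (i, t)) = 1" if "t \<in> {1..T}" for t
    using choice_set_sum[OF choice[OF that]] by simp
  have I_eq: "I (t + 1) i = real (c i) - (\<Sum>s=1..t. y (i, s))" if "t \<le> T" "i \<in> {1..n}" for t i
    using that(1)
  proof (induction t)
    case 0
    then show ?case using I1 that by simp
  next
    case (Suc t)
    then have "I (Suc t + 1) i = I (t + 1) i - y (i, Suc t)" using IS that by simp
    then show ?case using Suc by simp
  qed
  have I_int: "I t i \<in> \<int>" if "t \<in> {1..T}" "i \<in> {1..n}" for t i
  proof -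
    have "y (i, s) \<in> \<int>" if "s \<in> {1..t - 1}" for s
    proof -
      have "y (i, s) = 0 \<or> y (i, s) = 1"
        using that \<open>t \<in> {1..T}\<close> \<open>i \<in> {1..n}\<close> by (intro y01) auto
      then show ?thesis by (elim disjE) simp_all
    qed
    then have "(\<Sum>s=1..t - 1. y (i, s)) \<in> \<int>" by (rule Ints_sum)
    moreover have "I t i = real (c i) - (\<Sum>s=1..t - 1. y (i, s))"
      using I_eq[of "t - 1" i] that by auto
    ultimately show ?thesis by (simp add: Ints_diff)
  qed
  have inv: "(\<Sum>t=1..T. y (i, t)) \<le> real (c i)" if i: "i \<in> {1..n}" for i
  proof -
    have "I (T + 1) i = I T i - y (i, T)" "I T i \<ge> 0" using IS T i by auto
    moreover have "I T i \<ge> 1" if sold: "y (i, T) = 1"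
    proof -
      have "\<forall>j\<in>{0..n} - (available n (I T) \<union> {0}). y (j, T) = 0"
        using choice[of T] T by (simp add: choice_set_def)
      then have "i \<in> available n (I T)" using i sold by force
      then have "I T i > 0" by (simp add: available_def)
      moreover have "I T i \<in> \<int>" using I_int T i by simp
      ultimately show ?thesis by (auto elim!: Ints_cases)
    qed
    ultimately have "I (T + 1) i \<ge> 0" using y01[of i T] T i by auto
    then show ?thesis using I_eq[of T i] i by simp
  qed
  note price = PI_feasible_price_le[OF \<beta> yr]
  have unsold: "y (i, t) = 0" if "t \<in> {1..T}" "i \<in> {1..n} - sellable n a \<beta> \<eta> t" for i t
  proof -
    have "r (i, t) \<ge> 0" using r that by auto
    then show ?thesis using price[of i t] y01[of i t] that by (auto simp: sellable_def)
  qed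
  have "0 \<le> y (i, t) \<and> y (i, t) \<le> 1" if "i \<in> {0..n}" "t \<in> {1..T}" for i t
    using y01[OF that] by auto
  moreover have "y \<in> extensional ({0..n} \<times> {1..T})" using bin by (simp add: PiE_def)
  ultimately show ?thesis
    unfolding P_feasible_iff using unsold sum1 inv by blast
qed

section \<open>The flow network\<close>

text \<open>
  Vertex \<open>0\<close> is the source, \<open>t \<in> {1..T}\<close> is period \<open>t\<close>, \<open>T + 1 + i\<close> is option \<open>i\<close> and \<open>T + n + 2\<close>
  is the sink. The arc \<open>(i, t)\<close> leads from period \<open>t\<close> to option \<open>i\<close>, the arc \<open>(i, 0)\<close> from option \<open>i\<close>
  to the sink, and the arc \<open>(n + 1, t)\<close> from the source to period \<open>t\<close>.
\<close>
definition pricing_network :: "nat \<Rightarrow> nat \<Rightarrow> (nat, nat \<times> nat) pre_digraph" where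
  "pricing_network n T = \<lparr>
    verts = {0..T + n + 2},
    arcs = {0..n} \<times> {0..T} \<union> {n + 1} \<times> {1..T},
    tail = (\<lambda>(i, t). if i = n + 1 then 0 else if t = 0 then T + 1 + i else t),
    head = (\<lambda>(i, t). if i = n + 1 then t else if t = 0 then T + n + 2 else T + 1 + i)\<rparr>"

text \<open>Sales of unsellable products are excluded by capacity zero instead of by removing arcs,
  so that every variable keeps an arc of its own. No purchase is unlimited, which capacity
  \<open>T\<close> expresses for a flow of value \<open>T\<close>.\<close>

definition arc_capacity ::
  "nat \<Rightarrow> nat \<Rightarrow> (nat \<Rightarrow> nat) \<Rightarrow> (nat \<Rightarrow> nat set) \<Rightarrow> nat \<times> nat \<Rightarrow> nat" where
  "arc_capacity n T c B = (\<lambda>(i, t).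
    if i = n + 1 then 1
    else if t = 0 then (if i = 0 then T else c i)
    else if i = 0 \<or> i \<in> B t then 1 else 0)"

section \<open>Incidences and flow conservation in the network\<close>

lemma fin_digraph_pricing_network: "fin_digraph (pricing_network n T)"
  by unfold_locales (auto simp: pricing_network_def)

lemma arcs_pricing_network: "arcs (pricing_network n T) = {0..n} \<times> {0..T} \<union> {n + 1} \<times> {1..T}"
  by (simp add: pricing_network_def)

lemma pricing_network_source:
  "out_arcs (pricing_network n T) 0 = {n + 1} \<times> {1..T}" "in_arcs (pricing_network n T) 0 = {}"
  by (auto simp: pricing_network_def in_arcs_def out_arcs_def split: if_splits)

lemma pricing_network_period:
  assumes "t \<in> {1..T}"
  shows "out_arcs (pricing_network n T) t = {0..n} \<times> {t}" "in_arcs (pricing_network n T) t = {n + 1} \<times> {t}"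
  using assms by (auto simp: pricing_network_def in_arcs_def out_arcs_def split: if_splits)

lemma pricing_network_option:
  assumes "i \<in> {0..n}"
  shows "out_arcs (pricing_network n T) (T + 1 + i) = {i} \<times> {0}"
    "in_arcs (pricing_network n T) (T + 1 + i) = {i} \<times> {1..T}"
  using assms by (auto simp: pricing_network_def in_arcs_def out_arcs_def split: if_splits)

lemma inner_verts_pricing_network:
  "verts (pricing_network n T) - {0, T + n + 2} = {1..T} \<union> (\<lambda>i. T + 1 + i) ` {0..n}"
proof (intro set_eqI iffI)
  fix x assume "x \<in> verts (pricing_network n T) - {0, T + n + 2}"
  then have x: "0 < x" "x < T + n + 2" by (auto simp: pricing_network_def)
  show "x \<in> {1..T} \<union> (\<lambda>i. T + 1 + i) ` {0..n}"
  proof (cases "x \<le> T")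
    case False
    with x have "x = T + 1 + (x - T - 1)" "x - T - 1 \<in> {0..n}" by auto
    then show ?thesis by blast
  qed (use x in simp)
qed (auto simp: pricing_network_def)

text \<open>Each inner vertex has a single arc on one side: a period is entered only from the
  source, an option is left only to the sink. Conservation thus fixes the flow on these arcs as a
  sum over the variables.\<close>

lemma feasible_flows_pricing_network:
  "f \<in> feasible_flows (pricing_network n T) u 0 (T + n + 2) v \<longleftrightarrow>
    f \<in> (\<Pi>\<^sub>E e\<in>arcs (pricing_network n T). {0..real (u e)}) \<and>
    (\<forall>t\<in>{1..T}. (\<Sum>i=0..n. f (i, t)) = f (n + 1, t)) \<and>
    (\<forall>i\<in>{0..n}. f (i, 0) = (\<Sum>t=1..T. f (i, t))) \<and>
    (\<Sum>t=1..T. f (n + 1, t)) = v"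
proof -
  have "(\<forall>x\<in>verts (pricing_network n T) - {0, T + n + 2}.
      sum f (out_arcs (pricing_network n T) x) = sum f (in_arcs (pricing_network n T) x)) \<longleftrightarrow>
    (\<forall>t\<in>{1..T}. (\<Sum>i=0..n. f (i, t)) = f (n + 1, t)) \<and>
    (\<forall>i\<in>{0..n}. f (i, 0) = (\<Sum>t=1..T. f (i, t)))"
    unfolding inner_verts_pricing_network ball_Un ball_simps
    by (simp only: pricing_network_period pricing_network_option sum.cartesian_product' sum.insert
        sum.empty finite.emptyI empty_iff not_False_eq_True add_0_right cong: ball_cong)
  then show ?thesis
    by (simp add: feasible_flows_def pricing_network_source sum.cartesian_product')
qed

text \<open>The gaps \<open>1 - f x\<close> are nonnegative with sum zero. This saturates the source
  arcs: \<open>T\<close> units have to pass through \<open>T\<close> arcs of capacity one.\<close>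

lemma sum_eq_card_imp_eq_1:
  fixes f :: "'a \<Rightarrow> real"
  assumes "finite A" "\<And>x. x \<in> A \<Longrightarrow> f x \<le> 1" "sum f A = real (card A)" "x \<in> A"
  shows "f x = 1"
proof -
  have "(\<Sum>x\<in>A. 1 - f x) = 0" using assms by (simp add: sum_subtractf)
  then have "1 - f x = 0" using assms by (subst (asm) sum_nonneg_eq_0_iff) auto
  then show ?thesis by simp
qed

text \<open>A flow of value \<open>T\<close> is determined by its restriction to \<open>J\<close>:
  the source arcs are saturated, which gives one unit of choice per period, and conservation fixes
  the arcs into the sink, whose capacities encode the inventories. So restriction is a bijection
  with inverse \<open>extend\<close>.\<close>

lemma is_max_cost_flow_problem_P:
  "is_max_cost_flow_problem ({0..n} \<times> {1..T}) (P_feasible n T c a \<beta> \<eta>) (P_objective n T a \<beta> \<eta>)"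
proof -
  define G where "G = pricing_network n T"
  define u where "u = arc_capacity n T c (sellable n a \<beta> \<eta>)"
  define J where "J = {0..n} \<times> {1..T}"
  define \<rho> where "\<rho> = (\<lambda>p. if p \<in> {1..n} \<times> {1..T} then reservation_price a \<beta> \<eta> (fst p) (snd p) else 0)"
  define X where "X = feasible_flows G u 0 (T + n + 2) (real T)"
  define extend where "extend = (\<lambda>y. \<lambda>(i, t)\<in>arcs G.
    if i = n + 1 then 1 else if t = 0 then \<Sum>s=1..T. y (i, s) else y (i, t) :: real)"
  have arcs: "arcs G = {0..n} \<times> {0..T} \<union> {n + 1} \<times> {1..T}"
    by (simp add: G_def arcs_pricing_network)
  have X_iff: "f \<in> X \<longleftrightarrow>
      f \<in> extensional (arcs G) \<and> (\<forall>e\<in>arcs G. 0 \<le> f e \<and> f e \<le> real (u e)) \<and>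
      (\<forall>t\<in>{1..T}. (\<Sum>i=0..n. f (i, t)) = f (n + 1, t)) \<and>
      (\<forall>i\<in>{0..n}. f (i, 0) = (\<Sum>t=1..T. f (i, t))) \<and>
      (\<Sum>t=1..T. f (n + 1, t)) = real T" for f
    unfolding X_def G_def feasible_flows_pricing_network by (auto simp: PiE_def Pi_def)
  have source: "f (n + 1, t) = 1" if f: "f \<in> X" and t: "t \<in> {1..T}" for f t
  proof (rule sum_eq_card_imp_eq_1[of "{1..T}" "\<lambda>t. f (n + 1, t)"])
    fix t assume "t \<in> {1..T}"
    then have "(n + 1, t) \<in> arcs G" by (simp add: arcs)
    then have "f (n + 1, t) \<le> real (u (n + 1, t))" using f unfolding X_iff by blast
    then show "f (n + 1, t) \<le> 1" by (simp add: u_def arc_capacity_def)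
  qed (use f t in \<open>auto simp: X_iff\<close>)
  have to_P: "restrict f J \<in> P_feasible n T c a \<beta> \<eta>" if f: "f \<in> X" for f
    unfolding P_feasible_iff
  proof (intro conjI ballI)
    have cap: "0 \<le> f e \<and> f e \<le> real (u e)" if "e \<in> arcs G" for e
      using f that unfolding X_iff by blast
    {
      fix i t assume it: "i \<in> {0..n}" "t \<in> {1..T}"
      then have "0 \<le> f (i, t) \<and> f (i, t) \<le> real (u (i, t))" by (intro cap) (simp add: arcs)
      with it show "0 \<le> restrict f J (i, t)" "restrict f J (i, t) \<le> 1"
        by (auto simp: J_def u_def arc_capacity_def split: if_splits)
    }
    {
      fix i assume i: "i \<in> {1..n}"
      then have "(i, 0) \<in> arcs G" by (simp add: arcs)
      then have "f (i, 0) \<le> real (c i)" using cap[of "(i, 0)"] i by (simp add: u_def arc_capacity_def)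
      moreover have "f (i, 0) = (\<Sum>t=1..T. f (i, t))" using f i by (simp add: X_iff)
      ultimately show "(\<Sum>t=1..T. restrict f J (i, t)) \<le> real (c i)" using i by (simp add: J_def)
    }
    {
      fix t assume t: "t \<in> {1..T}"
      then have "(\<Sum>i=0..n. f (i, t)) = 1" using f source[OF f t] by (simp add: X_iff)
      with t show "(\<Sum>i=0..n. restrict f J (i, t)) = 1" by (simp add: J_def)
    }
    {
      fix t i assume it: "t \<in> {1..T}" "i \<in> {1..n} - sellable n a \<beta> \<eta> t"
      then have "(i, t) \<in> arcs G" by (auto simp: arcs)
      then have "f (i, t) = 0" using cap[of "(i, t)"] it by (simp add: u_def arc_capacity_def)
      with it show "restrict f J (i, t) = 0" by (simp add: J_def)
    }
  qed (auto simp: J_def)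
  have to_X: "extend y \<in> X" if y: "y \<in> P_feasible n T c a \<beta> \<eta>" for y
    unfolding X_iff
  proof (intro conjI ballI)
    have source': "extend y (n + 1, t) = 1" if "t \<in> {1..T}" for t
      using that by (simp add: extend_def arcs)
    have choice: "extend y (i, t) = y (i, t)" if "t \<in> {1..T}" "i \<in> {0..n}" for i t
      using that by (auto simp: extend_def arcs)
    have sink: "extend y (i, 0) = (\<Sum>s=1..T. y (i, s))" if "i \<in> {0..n}" for i
      using that by (auto simp: extend_def arcs)
    have unit: "0 \<le> y (i, t) \<and> y (i, t) \<le> 1" if "t \<in> {1..T}" "i \<in> {0..n}" for i t
      using y that by (simp add: P_feasible_iff)
    show "extend y \<in> extensional (arcs G)" by (simp add: extend_def)
    {
      fix e assume "e \<in> arcs G"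
      then have "e \<in> {0..n} \<times> {0..T} \<or> e \<in> {n + 1} \<times> {1..T}" by (simp only: arcs Un_iff)
      \<comment> \<open>The arc of no purchase into the sink is kept apart from those of the
        products, as its capacity is \<open>T\<close> rather than an inventory.\<close>
      then consider t where "e = (n + 1, t)" "t \<in> {1..T}" | "e = (0, 0)"
        | i where "e = (i, 0)" "i \<in> {1..n}" | i t where "e = (i, t)" "i \<in> {0..n}" "t \<in> {1..T}"
      proof (elim disjE SigmaE)
        fix i t assume "e = (i, t)" "i \<in> {0..n}" "t \<in> {0..T}"
        then show ?thesis using that(2) that(3)[of i] that(4)[of i t] by (cases "t = 0"; cases "i = 0") simp_all
      next
        fix i t assume "e = (i, t)" "i \<in> {n + 1}" "t \<in> {1..T}"
        then show ?thesis using that(1)[of t] by simp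
      qed
      then have "0 \<le> extend y e \<and> extend y e \<le> real (u e)"
      proof cases
        case 1
        then show ?thesis using source'[of t] by (simp add: u_def arc_capacity_def)
      next
        case 2
        have "0 \<le> (\<Sum>s=1..T. y (0, s))" using unit by (intro sum_nonneg) auto
        moreover have "(\<Sum>s=1..T. y (0, s)) \<le> (\<Sum>s=1..T. 1)" using unit by (intro sum_mono) auto
        ultimately show ?thesis using 2 sink[of 0] by (simp add: u_def arc_capacity_def)
      next
        case 3
        have "0 \<le> (\<Sum>s=1..T. y (i, s))" using unit 3 by (intro sum_nonneg) auto
        moreover have "(\<Sum>s=1..T. y (i, s)) \<le> real (c i)" using y 3 by (simp add: P_feasible_iff)
        ultimately show ?thesis using 3 sink[of i] by (simp add: u_def arc_capacity_def)
      next
        case 4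
        have "y (i, t) = 0" if "\<not> (i = 0 \<or> i \<in> sellable n a \<beta> \<eta> t)"
          using y that 4 unfolding P_feasible_iff by simp
        then show ?thesis using 4 unit[of t i] choice[of t i] by (auto simp: u_def arc_capacity_def)
      qed
      then show "0 \<le> extend y e" "extend y e \<le> real (u e)" by simp_all
    }
    show "(\<Sum>i=0..n. extend y (i, t)) = extend y (n + 1, t)" if "t \<in> {1..T}" for t
      using y that source'[OF that] choice[OF that] by (simp add: P_feasible_iff)
    show "extend y (i, 0) = (\<Sum>t=1..T. extend y (i, t))" if "i \<in> {0..n}" for i
      using sink[OF that] choice that by simp
    show "(\<Sum>t=1..T. extend y (n + 1, t)) = real T"
      using source' by simp
  qed
  have "bij_betw (\<lambda>f. restrict f J) X (P_feasible n T c a \<beta> \<eta>)"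
  proof (rule bij_betwI[where g = extend])
    show "extend (restrict f J) = f" if f: "f \<in> X" for f
    proof (rule extensionalityI[of _ "arcs G"])
      show "f \<in> extensional (arcs G)" using f by (simp add: X_iff)
      fix e assume e: "e \<in> arcs G"
      obtain i t where it: "e = (i, t)" by (cases e)
      show "extend (restrict f J) e = f e"
        using e f source[OF f, of t] by (auto simp: extend_def it arcs J_def X_iff)
    qed (simp add: extend_def)
    show "restrict (extend y) J = y" if y: "y \<in> P_feasible n T c a \<beta> \<eta>" for y
    proof (rule extensionalityI[of _ J])
      show "y \<in> extensional J" using y unfolding P_feasible_iff J_def by (rule conjunct1)
      fix e assume "e \<in> J"
      then show "restrict (extend y) J e = y e" by (auto simp: extend_def arcs J_def)
    qed simp
  qed (use to_P to_X in auto)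
  moreover have "(\<Sum>e\<in>arcs G. \<rho> e * f e) = P_objective n T a \<beta> \<eta> (restrict f J)" for f
    unfolding \<rho>_def by (rule P_objective_eq_weighted_sum) (auto simp: arcs J_def)
  moreover have "fin_digraph G" by (simp add: G_def fin_digraph_pricing_network)
  moreover have "0 \<in> verts G" "T + n + 2 \<in> verts G" by (simp_all add: G_def pricing_network_def)
  moreover have "J \<subseteq> arcs G" by (auto simp: arcs J_def)
  \<comment> \<open>An arc is labelled by the index of the variable it carries, so the identity
    serves as \<open>arc_of\<close>.\<close>
  ultimately show ?thesis
    unfolding is_max_cost_flow_problem_def J_def[symmetric] X_def
    by (intro exI[of _ G] exI[of _ u] exI[of _ \<rho>] exI[of _ 0] exI[of _ "T + n + 2"]
        exI[of _ "real T"] exI[of _ "\<lambda>p. p"]) simp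
qed

section \<open>Equal optimal values and transfer of integral optima\<close>

theorem proposition4:
  fixes n T :: nat and c :: "nat \<Rightarrow> nat" and a :: "nat \<Rightarrow> real" and \<beta> :: real
    and \<eta> :: "nat \<Rightarrow> nat \<Rightarrow> real"
  assumes "n \<ge> 1" and "T \<ge> 1" and "\<beta> > 0"
  shows
    "optimal_value (P_objective n T a \<beta> \<eta>) (P_feasible n T c a \<beta> \<eta>) =
       optimal_value (PI_objective n T) (PI_feasible n T c a \<beta> \<eta>) \<and>
     (\<forall>y. optimal (P_objective n T a \<beta> \<eta>) (P_feasible n T c a \<beta> \<eta>) y \<and>
          (\<forall>p\<in>{0..n} \<times> {1..T}. y p \<in> \<int>) \<longrightarrow>
        (\<exists>r. optimal (PI_objective n T) (PI_feasible n T c a \<beta> \<eta>) (y, r))) \<and>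
     is_max_cost_flow_problem ({0..n} \<times> {1..T})
       (P_feasible n T c a \<beta> \<eta>) (P_objective n T a \<beta> \<eta>) \<and>
     (\<exists>y. optimal (P_objective n T a \<beta> \<eta>) (P_feasible n T c a \<beta> \<eta>) y \<and>
        (\<forall>p\<in>{0..n} \<times> {1..T}. y p \<in> \<int>))"


proof -
  let ?f = "P_objective n T a \<beta> \<eta>" and ?F = "P_feasible n T c a \<beta> \<eta>"
  have lift: "\<exists>r. optimal (PI_objective n T) (PI_feasible n T c a \<beta> \<eta>) (y, r) \<and>
      PI_objective n T (y, r) = ?f y"
    if y: "optimal ?f ?F y" "\<forall>p\<in>{0..n} \<times> {1..T}. y p \<in> \<int>" for y
  proof -
    have yF: "y \<in> ?F" using y(1) by (simp add: optimal_iff)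
    define r where "r = reservation_prices n T a \<beta> \<eta>"
    have obj: "PI_objective n T (y, r) = ?f y"
      using PI_objective_reservation_prices[OF yF] by (simp only: r_def)
    have "(y, r) \<in> PI_feasible n T c a \<beta> \<eta>"
      using PI_feasible_reservation_prices[OF \<open>\<beta> > 0\<close> yF y(2)] by (simp only: r_def)
    \<comment> \<open>A competitor earns at most the program's value of its own choices
      \<open>y'\<close>, which are feasible for the program and hence do not beat
      \<open>y\<close>.\<close>
    moreover have "PI_objective n T p \<le> PI_objective n T (y, r)"
      if "p \<in> PI_feasible n T c a \<beta> \<eta>" for p
    proof -
      obtain y' r' where p: "p = (y', r')" by (cases p)
      have "PI_objective n T p \<le> ?f y'" "y' \<in> ?F"
        using PI_objective_le_P_objective P_feasible_of_PI_feasible \<open>\<beta> > 0\<close> \<open>T \<ge> 1\<close> that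
        unfolding p by blast+
      then show ?thesis using y(1) unfolding optimal_iff obj by force
    qed
    ultimately show ?thesis using obj unfolding optimal_iff by blast
  qed
  obtain y where y: "optimal ?f ?F y" "\<forall>p\<in>{0..n} \<times> {1..T}. y p \<in> \<int>"
    using integral_P_optimal_exists by blast
  obtain r where "optimal (PI_objective n T) (PI_feasible n T c a \<beta> \<eta>) (y, r)"
    "PI_objective n T (y, r) = ?f y"
    using lift[OF y] by blast
  \<comment> \<open>Both suprema are attained, at \<open>y\<close> and at \<open>(y, r)\<close>,
    with the same value.\<close>
  then have "optimal_value ?f ?F = optimal_value (PI_objective n T) (PI_feasible n T c a \<beta> \<eta>)"
    using optimal_value_eq y(1) by metis
  then show ?thesis using lift y is_max_cost_flow_problem_P by blast
qed

end
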